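(* Let $C_i\subseteq\mathbb F_q^{n_i}$ ($i\in[t]$) be classical codes and let $c\in C_1\boxplus\cdots\boxplus C_t$. For any two decompositions $c=c_1+\cdots+c_t=c_1'+\cdots+c_t'$ with $c_i,c_i'\in C^{(i)}$ for all $i\in[t]$, there exist $c_{i,j}\in C^{(i,j)}$ for $1\le i<j\le t$ such that for all $i\in[t]$, $$c_i-c_i'=\sum_{j=1}^{i-1}c_{j,i}-\sum_{j=i+1}^{t}c_{i,j}.$$
   Context: Identify $\mathbb F_q^{n_1}\otimes\cdots\otimes\mathbb F_q^{n_t}$ with $t$-dimensional arrays; a direction-$i$ column is the vector in $\mathbb F_q^{n_i}$ obtained by fixing all coordinates except the $i$-th. $C^{(i)}=\mathbb F_q^{n_1}\otimes\cdots\otimes C_i\otimes\cdots\otimes\mathbb F_q^{n_t}$ is the space of arrays all of whose direction-$i$ columns lie in $C_i$; $C^{(i,j)}=C^{(i)}\cap C^{(j)}$; $C_1\boxplus\cdots\boxplus C_t=C^{(1)}+\cdots+C^{(t)}$. *)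

theory Defs
  imports Main "HOL-Library.Function_Algebras"
begin

text \<open>Tensor-product arrays in F^{n_0} (x) ... (x) F^{n_{t-1}} (directions indexed 0..t-1).\<close>

definition idx_box :: "nat \<Rightarrow> (nat \<Rightarrow> nat) \<Rightarrow> (nat \<Rightarrow> nat) set" where
  "idx_box t n = {x. (\<forall>k<t. x k < n k) \<and> (\<forall>k. t \<le> k \<longrightarrow> x k = 0)}"

definition arrays :: "nat \<Rightarrow> (nat \<Rightarrow> nat) \<Rightarrow> ((nat \<Rightarrow> nat) \<Rightarrow> 'a::zero) set" where
  "arrays t n = {A. \<forall>x. x \<notin> idx_box t n \<longrightarrow> A x = 0}"

definition vecs :: "nat \<Rightarrow> (nat \<Rightarrow> 'a::zero) set" where
  "vecs m = {v. \<forall>j. m \<le> j \<longrightarrow> v j = 0}"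

definition lin_code :: "nat \<Rightarrow> (nat \<Rightarrow> 'a::field) set \<Rightarrow> bool" where
  "lin_code m C \<longleftrightarrow> C \<subseteq> vecs m \<and> 0 \<in> C \<and>
     (\<forall>u\<in>C. \<forall>v\<in>C. u + v \<in> C) \<and> (\<forall>a. \<forall>u\<in>C. (\<lambda>j. a * u j) \<in> C)"

definition col :: "(nat \<Rightarrow> nat) \<Rightarrow> ((nat \<Rightarrow> nat) \<Rightarrow> 'a::zero) \<Rightarrow> nat \<Rightarrow> (nat \<Rightarrow> nat) \<Rightarrow> (nat \<Rightarrow> 'a)" where
  "col n A i x = (\<lambda>j. if j < n i then A (x(i := j)) else 0)"

definition Cdir :: "nat \<Rightarrow> (nat \<Rightarrow> nat) \<Rightarrow> (nat \<Rightarrow> (nat \<Rightarrow> 'a::zero) set) \<Rightarrow> nat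
    \<Rightarrow> ((nat \<Rightarrow> nat) \<Rightarrow> 'a) set" where
  "Cdir t n C i = {A \<in> arrays t n. \<forall>x\<in>idx_box t n. col n A i x \<in> C i}"

definition Cpair :: "nat \<Rightarrow> (nat \<Rightarrow> nat) \<Rightarrow> (nat \<Rightarrow> (nat \<Rightarrow> 'a::zero) set) \<Rightarrow> nat \<Rightarrow> nat
    \<Rightarrow> ((nat \<Rightarrow> nat) \<Rightarrow> 'a) set" where
  "Cpair t n C i j = Cdir t n C i \<inter> Cdir t n C j"

definition boxplus :: "nat \<Rightarrow> (nat \<Rightarrow> nat) \<Rightarrow> (nat \<Rightarrow> (nat \<Rightarrow> 'a::comm_monoid_add) set)
    \<Rightarrow> ((nat \<Rightarrow> nat) \<Rightarrow> 'a) set" where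
  "boxplus t n C = {\<Sum>i<t. a i | a. \<forall>i<t. a i \<in> Cdir t n C i}"

end

theory Submission
  imports Defs "HOL.Vector_Spaces"
begin

text \<open>For each code \<open>C m\<close> fix a linear projection \<open>\<pi> m\<close> of \<open>F^(n m)\<close> onto \<open>C m\<close>, and let
  \<open>P m\<close> apply \<open>\<pi> m\<close> to every direction-\<open>m\<close> column of an array. Then \<open>P m\<close> maps all arrays
  onto \<open>C^(m)\<close>, fixes \<open>C^(m)\<close> pointwise, and preserves \<open>C^(j)\<close> for \<open>j \<noteq> m\<close>, because a
  direction-\<open>j\<close> column of \<open>P m A\<close> is a linear combination of direction-\<open>j\<close> columns of \<open>A\<close>.
  The differences \<open>d i = c i - c' i\<close> lie in \<open>C^(i)\<close> and sum to zero. Put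
  \<open>R i = (1 - P (i-1)) \<circ> \<dots> \<circ> (1 - P 0)\<close> and \<open>c(i,j) = P i (R i (d j))\<close>. Then \<open>\<Sum>j<i. c(j,i)\<close>
  telescopes to \<open>d i - R i (d i)\<close>, while \<open>R i\<close> annihilates \<open>d j\<close> for \<open>j < i\<close>, so
  \<open>\<Sum>j>i. c(i,j) = P i (R i (- d i - (\<Sum>j<i. d j))) = - R i (d i)\<close>.\<close>

lemma sum_lessThan_split:
  fixes d :: "nat \<Rightarrow> 'b::comm_monoid_add"
  assumes "i < t"
  shows "(\<Sum>j<t. d j) = (\<Sum>j<i. d j) + d i + (\<Sum>j\<in>{i<..<t}. d j)"
proof -
  have split: "{..<t} = {..<Suc i} \<union> {i<..<t}" using assms by auto
  have "(\<Sum>j<t. d j) = (\<Sum>j<Suc i. d j) + (\<Sum>j\<in>{i<..<t}. d j)"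
    unfolding split by (rule sum.union_disjoint) auto
  then show ?thesis by simp
qed

locale compatible_projections =
  fixes t :: nat and D :: "nat \<Rightarrow> 'b::ab_group_add set" and P :: "nat \<Rightarrow> 'b \<Rightarrow> 'b"
  assumes diff_mem: "j < t \<Longrightarrow> x \<in> D j \<Longrightarrow> y \<in> D j \<Longrightarrow> x - y \<in> D j"
    and additive: "m < t \<Longrightarrow> additive (P m)"
    and range_subset: "m < t \<Longrightarrow> P m x \<in> D m"
    and fixes_mem: "m < t \<Longrightarrow> x \<in> D m \<Longrightarrow> P m x = x"
    and preserves_mem: "m < t \<Longrightarrow> j < t \<Longrightarrow> j \<noteq> m \<Longrightarrow> x \<in> D j \<Longrightarrow> P m x \<in> D j"
begin

primrec residual :: "nat \<Rightarrow> 'b \<Rightarrow> 'b" where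
  "residual 0 x = x"
| "residual (Suc k) x = residual k x - P k (residual k x)"

lemma sum_residual_telescope: "(\<Sum>j<k. P j (residual j x)) = x - residual k x"
  by (induction k) simp_all

lemma additive_residual: "k \<le> t \<Longrightarrow> additive (residual k)"
proof (induction k)
  case 0
  show ?case by (simp add: additive_def)
next
  case (Suc k)
  then have "additive (residual k)" and "additive (P k)" by (simp_all add: additive)
  then show ?case by (simp add: additive_def additive.add)
qed

lemma residual_mem: "i < t \<Longrightarrow> k \<le> i \<Longrightarrow> x \<in> D i \<Longrightarrow> residual k x \<in> D i"
  by (induction k) (simp_all add: diff_mem preserves_mem)

lemma residual_vanishes: "j < k \<Longrightarrow> k \<le> t \<Longrightarrow> x \<in> D j \<Longrightarrow> residual k x = 0"
proof (induction k)
  case 0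
  then show ?case by simp
next
  case (Suc k)
  show ?case
  proof (cases "j = k")
    case True
    then have "residual k x \<in> D j" using Suc.prems by (intro residual_mem) auto
    then show ?thesis using True Suc.prems by (simp add: fixes_mem)
  next
    case False
    then have "residual k x = 0" using Suc by simp
    then show ?thesis using Suc.prems additive.zero[OF additive] by simp
  qed
qed

lemma residual_decomposition:
  assumes mem: "\<forall>i<t. d i \<in> D i" and zero_sum: "(\<Sum>i<t. d i) = 0" and i: "i < t"
  shows "d i = (\<Sum>j<i. P j (residual j (d i))) - (\<Sum>j\<in>{i<..<t}. P i (residual i (d j)))"
proof -
  define r where "r = residual i (d i)"
  have r_mem: "r \<in> D i" unfolding r_def using i mem by (simp add: residual_mem)
  have "(\<Sum>j\<in>{i<..<t}. d j) = - d i - (\<Sum>j<i. d j)"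
    using zero_sum sum_lessThan_split[OF i, of d] by (simp add: algebra_simps eq_neg_iff_add_eq_0)
  then have "residual i (\<Sum>j\<in>{i<..<t}. d j) = - r - (\<Sum>j<i. residual i (d j))"
    using additive_residual[of i] i by (simp add: r_def additive.diff additive.minus additive.sum)
  also have "\<dots> = - r"
    using i mem by (simp add: residual_vanishes)
  finally have tail: "residual i (\<Sum>j\<in>{i<..<t}. d j) = - r" .
  have "(\<Sum>j\<in>{i<..<t}. P i (residual i (d j))) = P i (residual i (\<Sum>j\<in>{i<..<t}. d j))"
    using i by (simp add: additive.sum[OF additive[OF i]] additive.sum[OF additive_residual])
  also have "\<dots> = P i (- r)"
    unfolding tail ..
  also have "\<dots> = - r"
    using r_mem additive[OF i] i by (simp add: additive.minus fixes_mem)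
  finally show ?thesis
    unfolding sum_residual_telescope r_def by simp
qed

theorem zero_sum_decomposition:
  assumes "\<forall>i<t. d i \<in> D i" and "(\<Sum>i<t. d i) = 0"
  shows "\<exists>cc. (\<forall>i j. i < j \<and> j < t \<longrightarrow> cc i j \<in> D i \<inter> D j) \<and>
           (\<forall>i<t. d i = (\<Sum>j<i. cc j i) - (\<Sum>j\<in>{i<..<t}. cc i j))"
  using assms residual_decomposition
  by (intro exI[of _ "\<lambda>i j. P i (residual i (d j))"])
    (simp add: range_subset preserves_mem residual_mem)

end

definition scale_vec :: "'a::field \<Rightarrow> (nat \<Rightarrow> 'a) \<Rightarrow> nat \<Rightarrow> 'a" where
  "scale_vec a v = (\<lambda>j. a * v j)"

interpretation vec: vector_space "scale_vec :: 'a::field \<Rightarrow> _"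
  by unfold_locales (auto simp: scale_vec_def algebra_simps fun_eq_iff)

interpretation vec_pair: vector_space_pair "scale_vec :: 'a::field \<Rightarrow> _" "scale_vec :: 'a \<Rightarrow> _" ..

lemma lin_code_subspace: "lin_code m C \<Longrightarrow> vec.subspace C"
  unfolding lin_code_def vec.subspace_def scale_vec_def by auto

lemma lin_code_projection:
  assumes "lin_code m (C :: (nat \<Rightarrow> 'a::field) set)"
  shows "\<exists>\<pi>. Vector_Spaces.linear scale_vec scale_vec \<pi> \<and> range \<pi> \<subseteq> C \<and> (\<forall>v\<in>C. \<pi> v = v)"
proof -
  obtain B where B: "B \<subseteq> C" "vec.independent B" "C \<subseteq> vec.span B"
    using vec.maximal_independent_subset by blast
  then have span_B: "vec.span B = C"
    using lin_code_subspace[OF assms] by (metis vec.span_minimal subset_antisym)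
  obtain \<pi> where lin: "Vector_Spaces.linear scale_vec scale_vec \<pi>"
    and on_B: "\<forall>v\<in>B. \<pi> v = id v" and range: "range \<pi> = vec.span (id ` B)"
    using vec_pair.linear_independent_extend_subspace[OF B(2)] by blast
  have "\<pi> v = id v" if "v \<in> C" for v
    using vec_pair.linear_eq_on[OF lin vec.linear_id] that span_B on_B by blast
  then show ?thesis using lin range span_B by auto
qed

lemma sum_fun_apply: "(\<Sum>i\<in>S. f i) x = (\<Sum>i\<in>S. f i x)"
  by (induction S rule: infinite_finite_induct) auto

definition unit_vec :: "nat \<Rightarrow> nat \<Rightarrow> 'a::field" where
  "unit_vec l = (\<lambda>k. if k = l then 1 else 0)"

lemma vecs_expansion: "v \<in> vecs m \<Longrightarrow> v = (\<Sum>l<m. scale_vec (v l) (unit_vec l))"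
  by (rule ext) (auto simp: vecs_def scale_vec_def unit_vec_def sum_fun_apply if_distrib cong: if_cong)

lemma linear_vecs_expansion:
  assumes "Vector_Spaces.linear scale_vec scale_vec \<pi>" and "v \<in> vecs m"
  shows "\<pi> v = (\<Sum>l<m. scale_vec (v l) (\<pi> (unit_vec l)))"
  by (subst vecs_expansion[OF assms(2)])
    (simp add: vec_pair.linear_sum[OF assms(1)] vec_pair.linear_scale[OF assms(1)])

lemma col_mem_vecs: "col n A m x \<in> vecs (n m)"
  by (simp add: col_def vecs_def)

lemma Cdir_diff:
  assumes "lin_code (n j) (C j)" and "A \<in> Cdir t n C j" and "B \<in> Cdir t n C j"
  shows "A - B \<in> Cdir t n C j"
proof -
  have "col n (A - B) j x = col n A j x - col n B j x" for x
    by (auto simp: col_def)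
  then show ?thesis
    using assms vec.subspace_diff[OF lin_code_subspace[OF assms(1)]]
    by (auto simp: Cdir_def arrays_def)
qed

definition apply_along :: "nat \<Rightarrow> (nat \<Rightarrow> nat) \<Rightarrow> nat \<Rightarrow> ((nat \<Rightarrow> 'a) \<Rightarrow> nat \<Rightarrow> 'a)
    \<Rightarrow> ((nat \<Rightarrow> nat) \<Rightarrow> 'a::zero) \<Rightarrow> (nat \<Rightarrow> nat) \<Rightarrow> 'a" where
  "apply_along t n m \<pi> A = (\<lambda>x. if x \<in> idx_box t n then \<pi> (col n A m x) (x m) else 0)"

lemma idx_box_upd: "x \<in> idx_box t n \<Longrightarrow> m < t \<Longrightarrow> j < n m \<Longrightarrow> x(m := j) \<in> idx_box t n"
  by (auto simp: idx_box_def)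

lemma col_fun_upd: "col n A m (x(m := j)) = col n A m x"
  unfolding col_def fun_upd_upd ..

lemma col_apply_along:
  assumes "m < t" and "y \<in> idx_box t n" and "range \<pi> \<subseteq> vecs (n m)"
  shows "col n (apply_along t n m \<pi> A) m y = \<pi> (col n A m y)"
proof
  fix j
  show "col n (apply_along t n m \<pi> A) m y j = \<pi> (col n A m y) j"
  proof (cases "j < n m")
    case True
    then have "y(m := j) \<in> idx_box t n" using assms by (simp add: idx_box_upd)
    then have "apply_along t n m \<pi> A (y(m := j)) = \<pi> (col n A m y) j"
      by (simp add: apply_along_def col_fun_upd)
    then show ?thesis using True by (simp add: col_def)
  next
    case False
    have "\<pi> (col n A m y) \<in> vecs (n m)" using assms(3) by auto
    then have "\<pi> (col n A m y) j = 0" using False by (simp add: vecs_def)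
    then show ?thesis using False by (simp add: col_def)
  qed
qed

lemma apply_along_in_Cdir:
  assumes "m < t" and "range \<pi> \<subseteq> C m" and "C m \<subseteq> vecs (n m)"
  shows "apply_along t n m \<pi> A \<in> Cdir t n C m"
  unfolding Cdir_def
proof (intro CollectI conjI ballI)
  show "apply_along t n m \<pi> A \<in> arrays t n" by (simp add: arrays_def apply_along_def)
  fix y assume "y \<in> idx_box t n"
  then have "col n (apply_along t n m \<pi> A) m y = \<pi> (col n A m y)"
    using assms by (intro col_apply_along) auto
  then show "col n (apply_along t n m \<pi> A) m y \<in> C m" using assms(2) by auto
qed

lemma apply_along_fixes_Cdir:
  assumes "m < t" and "\<forall>v\<in>C m. \<pi> v = v" and "A \<in> Cdir t n C m"
  shows "apply_along t n m \<pi> A = A"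
proof
  fix x
  show "apply_along t n m \<pi> A x = A x"
  proof (cases "x \<in> idx_box t n")
    case True
    then have "\<pi> (col n A m x) = col n A m x" using assms by (simp add: Cdir_def)
    then show ?thesis using True assms(1) by (auto simp: apply_along_def col_def idx_box_def)
  next
    case False
    then show ?thesis using assms by (simp add: apply_along_def Cdir_def arrays_def)
  qed
qed

lemma additive_apply_along:
  assumes "Vector_Spaces.linear scale_vec scale_vec \<pi>"
  shows "additive (apply_along t n m \<pi>)"
proof
  fix A B :: "(nat \<Rightarrow> nat) \<Rightarrow> 'a"
  have "col n (A + B) m x = col n A m x + col n B m x" for x
    by (auto simp: col_def)
  then show "apply_along t n m \<pi> (A + B) = apply_along t n m \<pi> A + apply_along t n m \<pi> B"
    using vec_pair.linear_add[OF assms] by (auto simp: apply_along_def)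
qed

lemma col_apply_along_other:
  assumes lin: "Vector_Spaces.linear scale_vec scale_vec \<pi>" and "j < t" and "j \<noteq> m"
    and y: "y \<in> idx_box t n"
  shows "col n (apply_along t n m \<pi> A) j y
           = (\<Sum>l<n m. scale_vec (\<pi> (unit_vec l) (y m)) (col n A j (y(m := l))))"
proof
  fix k
  show "col n (apply_along t n m \<pi> A) j y k
          = (\<Sum>l<n m. scale_vec (\<pi> (unit_vec l) (y m)) (col n A j (y(m := l)))) k"
  proof (cases "k < n j")
    case True
    then have "y(j := k) \<in> idx_box t n" using assms by (simp add: idx_box_upd)
    have "col n (apply_along t n m \<pi> A) j y k = apply_along t n m \<pi> A (y(j := k))"
      using True by (simp add: col_def)
    also have "\<dots> = \<pi> (col n A m (y(j := k))) (y m)"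
      using \<open>y(j := k) \<in> idx_box t n\<close> \<open>j \<noteq> m\<close> by (simp add: apply_along_def)
    also have "\<dots> = (\<Sum>l<n m. col n A m (y(j := k)) l * \<pi> (unit_vec l) (y m))"
      by (simp add: linear_vecs_expansion[OF lin col_mem_vecs] sum_fun_apply scale_vec_def)
    also have "\<dots> = (\<Sum>l<n m. scale_vec (\<pi> (unit_vec l) (y m)) (col n A j (y(m := l)))) k"
      using True \<open>j \<noteq> m\<close>
      by (auto simp: sum_fun_apply scale_vec_def col_def fun_upd_twist intro!: sum.cong)
    finally show ?thesis .
  qed (simp add: col_def sum_fun_apply scale_vec_def)
qed

lemma apply_along_preserves_Cdir:
  assumes "m < t" and "j < t" and "j \<noteq> m" and lc: "lin_code (n j) (C j)"
    and lin: "Vector_Spaces.linear scale_vec scale_vec \<pi>" and A: "A \<in> Cdir t n C j"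
  shows "apply_along t n m \<pi> A \<in> Cdir t n C j"
  unfolding Cdir_def
proof (intro CollectI conjI ballI)
  show "apply_along t n m \<pi> A \<in> arrays t n" by (simp add: arrays_def apply_along_def)
  fix y assume y: "y \<in> idx_box t n"
  have "col n A j (y(m := l)) \<in> C j" if "l < n m" for l
    using A idx_box_upd[OF y \<open>m < t\<close> that] by (simp add: Cdir_def)
  then show "col n (apply_along t n m \<pi> A) j y \<in> C j"
    unfolding col_apply_along_other[OF lin \<open>j < t\<close> \<open>j \<noteq> m\<close> y]
    using lin_code_subspace[OF lc] by (auto intro: vec.subspace_sum vec.subspace_scale)
qed

lemma compatible_projections_Cdir:
  assumes codes: "\<forall>i<t. lin_code (n i) (C i)"
    and proj: "\<forall>m<t. Vector_Spaces.linear scale_vec scale_vec (\<pi> m) \<and> range (\<pi> m) \<subseteq> C m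
                     \<and> (\<forall>v\<in>C m. \<pi> m v = v)"
  shows "compatible_projections t (Cdir t n C) (\<lambda>m. apply_along t n m (\<pi> m))"
proof (rule compatible_projections.intro)
  show "apply_along t n m (\<pi> m) A \<in> Cdir t n C m" if "m < t" for m A
    using that proj codes by (intro apply_along_in_Cdir) (auto simp: lin_code_def)
  show "additive (apply_along t n m (\<pi> m))" if "m < t" for m
    using that proj by (simp add: additive_apply_along)
  show "apply_along t n m (\<pi> m) A = A" if "m < t" and "A \<in> Cdir t n C m" for m A
    using that proj by (intro apply_along_fixes_Cdir) auto
  show "apply_along t n m (\<pi> m) A \<in> Cdir t n C j"
    if "m < t" and "j < t" and "j \<noteq> m" and "A \<in> Cdir t n C j" for m j A
    using that proj codes by (simp add: apply_along_preserves_Cdir)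
qed (use codes Cdir_diff in blast)

theorem lemma3p1:
  fixes t :: nat and n :: "nat \<Rightarrow> nat"
    and C :: "nat \<Rightarrow> (nat \<Rightarrow> 'a::{finite,field}) set"
    and c :: "(nat \<Rightarrow> nat) \<Rightarrow> 'a"
    and cs cs' :: "nat \<Rightarrow> (nat \<Rightarrow> nat) \<Rightarrow> 'a"
  assumes codes: "\<forall>i<t. lin_code (n i) (C i)"
    and c_in: "c \<in> boxplus t n C"
    and dec1: "c = (\<Sum>i<t. cs i)" and mem1: "\<forall>i<t. cs i \<in> Cdir t n C i"
    and dec2: "c = (\<Sum>i<t. cs' i)" and mem2: "\<forall>i<t. cs' i \<in> Cdir t n C i"
  shows "\<exists>cc :: nat \<Rightarrow> nat \<Rightarrow> (nat \<Rightarrow> nat) \<Rightarrow> 'a.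
           (\<forall>i j. i < j \<and> j < t \<longrightarrow> cc i j \<in> Cpair t n C i j) \<and>
           (\<forall>i<t. cs i - cs' i = (\<Sum>j<i. cc j i) - (\<Sum>j\<in>{i<..<t}. cc i j))"
proof -
  have "\<forall>m<t. \<exists>\<pi>. Vector_Spaces.linear scale_vec scale_vec \<pi> \<and> range \<pi> \<subseteq> C m \<and> (\<forall>v\<in>C m. \<pi> v = v)"
    using codes lin_code_projection by blast
  then obtain \<pi> where "\<forall>m<t. Vector_Spaces.linear scale_vec scale_vec (\<pi> m) \<and> range (\<pi> m) \<subseteq> C m
                            \<and> (\<forall>v\<in>C m. \<pi> m v = v)"
    by metis
  then interpret compatible_projections t "Cdir t n C" "\<lambda>m. apply_along t n m (\<pi> m)"
    using codes by (intro compatible_projections_Cdir)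
  have "\<forall>i<t. cs i - cs' i \<in> Cdir t n C i"
    using codes mem1 mem2 by (simp add: Cdir_diff)
  moreover have "(\<Sum>i<t. cs i - cs' i) = 0"
    using dec1 dec2 by (simp add: sum_subtractf)
  ultimately show ?thesis
    using zero_sum_decomposition[of "\<lambda>i. cs i - cs' i"] by (simp add: Cpair_def)
qed

end
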